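(* Let $\mathcal{E}$ be the class of Kalmár elementary functions. Then $$\langle x+1,\ x\bmod y,\ 2^x\rangle\subsetneqq\mathcal{E}.$$
   Context: $\mathbb{N}$ is the set of non-negative integers. An ($r$-ary, $r\ge 1$) operation on $\mathbb{N}$ is a function $\mathbb{N}^r\to\mathbb{N}$. Truncated subtraction is $x \mathbin{\dot-} y:=\max(x-y,0)$. Conventions: $\lfloor x/0\rfloor:=0$, and $x\bmod y:=x \mathbin{\dot-} y\lfloor x/y\rfloor$, so that $x\bmod 0=x$. A set $S$ of operations on $\mathbb{N}$ is closed under substitution if, whenever $f\in S$ is $r$-ary and $g_1,\dots,g_r\in S$ are $n$-ary, the operation $\vec x\mapsto f(g_1(\vec x),\dots,g_r(\vec x))$ is in $S$. For a set $\mathcal{B}$ of operations on $\mathbb{N}$, $\langle\mathcal{B}\rangle$ denotes the closure under substitution of $\mathcal{B}\cup C\cup P$, where $C$ is the set of all constant operations on $\mathbb{N}$ (of every arity) and $P$ is the set of all projections $(x_1,\dots,x_n)\mapsto x_i$. Here $x+1$ and $2^x$ denote unary operations and $x\bmod y$ a binary operation. The Kalmár elementary functions, forming the class $\mathcal{E}$, are the elements of the smallest set of operations on $\mathbb{N}$ that contains the constants, the projections, the addition, and the truncated subtraction, and that is closed under substitution, bounded summation ($(\vec x,y)\mapsto\sum_{z<y}f(\vec x,z)$), and bounded multiplication ($(\vec x,y)\mapsto\prod_{z<y}f(\vec x,z)$). *)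

theory Defs
  imports HOL.Hull "HOL-Library.FuncSet"
begin

text \<open>An \<open>r\<close>-ary operation on the natural numbers is encoded as a pair of its arity \<open>r\<close> and a
  function on argument lists that is \<^const>\<open>undefined\<close> off the lists of length \<open>r\<close>. Thus two
  encodings are equal iff the arities agree and the operations agree on all arguments. The arity
  is part of the encoding, so operations of different arities are always different.\<close>

type_synonym operation = "nat \<times> (nat list \<Rightarrow> nat)"

abbreviation arity :: "operation \<Rightarrow> nat" where
  "arity \<equiv> fst"

abbreviation app :: "operation \<Rightarrow> nat list \<Rightarrow> nat" where
  "app \<equiv> snd"

definition operation :: "nat \<Rightarrow> (nat list \<Rightarrow> nat) \<Rightarrow> operation" where
  "operation r f = (r, restrict f {xs. length xs = r})"

definition unary :: "(nat \<Rightarrow> nat) \<Rightarrow> operation" where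
  "unary f = operation 1 (\<lambda>xs. f (xs ! 0))"

definition binary :: "(nat \<Rightarrow> nat \<Rightarrow> nat) \<Rightarrow> operation" where
  "binary f = operation 2 (\<lambda>xs. f (xs ! 0) (xs ! 1))"

lemma operation_eq_iff:
  "operation r f = operation s g \<longleftrightarrow> r = s \<and> (\<forall>xs. length xs = r \<longrightarrow> f xs = g xs)"
  by (auto simp: operation_def restrict_def fun_eq_iff)

definition all_operations :: "operation set" where
  "all_operations = {operation r f | r f. 1 \<le> r}"

definition constants :: "operation set" where
  "constants = {operation r (\<lambda>_. c) | r c. 1 \<le> r}"

definition projections :: "operation set" where
  "projections = {operation r (\<lambda>xs. xs ! i) | r i. i < r}"

definition closed_substitution :: "operation set \<Rightarrow> bool" where
  "closed_substitution S \<longleftrightarrow>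
     (\<forall>f\<in>S. \<forall>n gs. length gs = arity f \<and> (\<forall>g\<in>set gs. g \<in> S \<and> arity g = n) \<and> 1 \<le> n \<longrightarrow>
        operation n (\<lambda>xs. app f (map (\<lambda>g. app g xs) gs)) \<in> S)"

text \<open>The argument list of the following two operations is \<open>(x, y)\<close> with \<open>y\<close> the last argument
  and \<open>x\<close> a possibly empty tuple.\<close>

definition bounded_sum :: "operation \<Rightarrow> operation" where
  "bounded_sum f = operation (arity f) (\<lambda>xs. \<Sum>z<last xs. app f (butlast xs @ [z]))"

definition bounded_prod :: "operation \<Rightarrow> operation" where
  "bounded_prod f = operation (arity f) (\<lambda>xs. \<Prod>z<last xs. app f (butlast xs @ [z]))"

text \<open>Recall that \<open>P hull A\<close> is the intersection of all sets that include \<open>A\<close> and satisfy \<open>P\<close>.\<close>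

definition generated :: "operation set \<Rightarrow> operation set" ("\<langle>_\<rangle>") where
  "\<langle>B\<rangle> = closed_substitution hull (B \<union> constants \<union> projections)"

text \<open>Subtraction on \<^typ>\<open>nat\<close> is truncated.\<close>

definition kalmar_elementary :: "operation set" where
  "kalmar_elementary =
     (\<lambda>S. closed_substitution S \<and> (\<forall>f\<in>S. bounded_sum f \<in> S) \<and> (\<forall>f\<in>S. bounded_prod f \<in> S))
       hull (constants \<union> projections \<union> {binary (+), binary (-)})"

lemma closed_substitution_all_operations: "closed_substitution all_operations"
  by (auto simp: closed_substitution_def all_operations_def)

lemma closed_substitution_Inter:
  "\<forall>S\<in>T. closed_substitution S \<Longrightarrow> closed_substitution (\<Inter>T)"
  unfolding closed_substitution_def by fastforce

lemma generated_closed: "closed_substitution \<langle>B\<rangle>"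
  unfolding generated_def by (rule hull_in) (use closed_substitution_Inter in blast)

lemma generated_subset_all_operations:
  assumes "B \<subseteq> all_operations"
  shows "\<langle>B\<rangle> \<subseteq> all_operations"
  unfolding generated_def
  by (rule hull_minimal)
     (use assms closed_substitution_all_operations in
       \<open>force simp: constants_def projections_def all_operations_def\<close>)+

lemma kalmar_elementary_closed:
  "closed_substitution kalmar_elementary \<and>
     (\<forall>f\<in>kalmar_elementary. bounded_sum f \<in> kalmar_elementary) \<and>
     (\<forall>f\<in>kalmar_elementary. bounded_prod f \<in> kalmar_elementary)"
  unfolding kalmar_elementary_def by (rule hull_in) (use closed_substitution_Inter in blast)

lemma kalmar_elementary_subset_all_operations: "kalmar_elementary \<subseteq> all_operations"
  unfolding kalmar_elementary_def
proof (rule hull_minimal)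
  show "constants \<union> projections \<union> {binary (+), binary (-)} \<subseteq> all_operations"
    by (force simp: constants_def projections_def binary_def all_operations_def)
  show "closed_substitution all_operations \<and> (\<forall>f\<in>all_operations. bounded_sum f \<in> all_operations) \<and>
      (\<forall>f\<in>all_operations. bounded_prod f \<in> all_operations)"
    using closed_substitution_all_operations
    by (force simp: bounded_sum_def bounded_prod_def all_operations_def operation_def)
qed

text \<open>On \<^typ>\<open>nat\<close>, \<^const>\<open>divide\<close> and \<^const>\<open>modulo\<close> follow the conventions for zero divisors
  that are intended here.\<close>

lemma nat_div_mod_conventions:
  fixes x y :: nat
  shows "x div 0 = 0" "x mod y = x - y * (x div y)" "x mod 0 = x"
  by (simp_all add: minus_mult_div_eq_mod)

end

theory Submission imports Defs begin

text \<open>Addition separates the two classes. Fix \<open>y\<close> and let \<open>x\<close> run through \<open>{0..n}\<close>. By induction on its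
  construction, a term \<open>t(x, y)\<close> over \<open>x + 1\<close>, \<open>x mod y\<close> and \<open>2\<^sup>x\<close> takes, besides values bounded
  independently of \<open>y\<close>, only a number of values that is bounded independently of both \<open>n\<close> and \<open>y\<close>:
  a remainder \<open>a mod b\<close> is bounded if \<open>a\<close> or a nonzero \<open>b\<close> is bounded, so each exceptional remainder
  arises from one of the few exceptional values of \<open>a\<close> together with \<open>0\<close> or one of the few
  exceptional values of \<open>b\<close>. But \<open>x + y\<close> takes \<open>n + 1\<close> values, all of them at least \<open>y\<close>.\<close>

section \<open>Closure properties of the elementary functions\<close>

text \<open>This form speaks of plain list functions. The restrictions inside
  \<open>operation\<close> vanish because the outer \<open>operation n\<close> compares only lists
  of length \<open>n\<close> and \<open>f\<close> receives a list of length
  \<open>r\<close>.\<close>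

lemma closed_substitutionD:
  assumes "closed_substitution S" "operation r f \<in> S" "length gs = r" "1 \<le> n"
    and gs: "\<And>g. g \<in> set gs \<Longrightarrow> operation n g \<in> S"
  shows "operation n (\<lambda>xs. f (map (\<lambda>g. g xs) gs)) \<in> S"
proof -
  have "operation n (\<lambda>xs. app (operation r f) (map (\<lambda>g. app g xs) (map (operation n) gs))) \<in> S"
    using \<open>closed_substitution S\<close>[unfolded closed_substitution_def, rule_format,
        OF \<open>operation r f \<in> S\<close>, of "map (operation n) gs" n]
      \<open>length gs = r\<close> \<open>1 \<le> n\<close> gs
    by (auto simp: operation_def)
  also have "operation n (\<lambda>xs. app (operation r f) (map (\<lambda>g. app g xs) (map (operation n) gs)))
      = operation n (\<lambda>xs. f (map (\<lambda>g. g xs) gs))"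
    using \<open>length gs = r\<close> by (simp add: operation_eq_iff) (simp add: operation_def comp_def)
  finally show ?thesis .
qed

lemma kalmar_elementary_base:
  "constants \<union> projections \<union> {binary (+), binary (-)} \<subseteq> kalmar_elementary"
  unfolding kalmar_elementary_def by (rule hull_subset)

lemma kalmar_elementary_const: "1 \<le> n \<Longrightarrow> operation n (\<lambda>_. c) \<in> kalmar_elementary"
  using kalmar_elementary_base by (auto simp: constants_def)

lemma kalmar_elementary_nth: "i < n \<Longrightarrow> operation n (\<lambda>xs. xs ! i) \<in> kalmar_elementary"
  using kalmar_elementary_base by (auto simp: projections_def)

lemma kalmar_elementary_binary:
  assumes "binary h \<in> kalmar_elementary" "1 \<le> n"
    and "operation n f \<in> kalmar_elementary" "operation n g \<in> kalmar_elementary"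
  shows "operation n (\<lambda>xs. h (f xs) (g xs)) \<in> kalmar_elementary"
  using closed_substitutionD[of kalmar_elementary 2 "\<lambda>xs. h (xs ! 0) (xs ! 1)" "[f, g]" n]
    assms kalmar_elementary_closed
  by (auto simp: binary_def)

lemmas kalmar_elementary_add = kalmar_elementary_binary[of "(+)"]
  and kalmar_elementary_diff = kalmar_elementary_binary[of "(-)"]

lemma kalmar_elementary_sum:
  assumes "operation n f \<in> kalmar_elementary"
  shows "operation n (\<lambda>xs. \<Sum>z<last xs. f (butlast xs @ [z])) \<in> kalmar_elementary"
proof (cases n)
  \<comment> \<open>Arity 0 is contradictory, as every elementary function has positive arity. It
    must be split off because \<open>butlast [] @ [z]\<close> has length 1, where an operation of
    arity 0 is \<open>undefined\<close>.\<close>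
  case 0
  then show ?thesis
    using assms kalmar_elementary_subset_all_operations
    by (auto simp: all_operations_def operation_def)
next
  case (Suc m)
  then have "bounded_sum (operation n f) = operation n (\<lambda>xs. \<Sum>z<last xs. f (butlast xs @ [z]))"
    by (auto simp: bounded_sum_def operation_def restrict_def fun_eq_iff)
  then show ?thesis
    using assms kalmar_elementary_closed by metis
qed

lemma kalmar_elementary_prod:
  assumes "operation n f \<in> kalmar_elementary"
  shows "operation n (\<lambda>xs. \<Prod>z<last xs. f (butlast xs @ [z])) \<in> kalmar_elementary"
proof (cases n)
  case 0
  then show ?thesis
    using assms kalmar_elementary_subset_all_operations
    by (auto simp: all_operations_def operation_def)
next
  case (Suc m)
  then have "bounded_prod (operation n f) = operation n (\<lambda>xs. \<Prod>z<last xs. f (butlast xs @ [z]))"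
    by (auto simp: bounded_prod_def operation_def restrict_def fun_eq_iff)
  then show ?thesis
    using assms kalmar_elementary_closed by metis
qed

lemma kalmar_elementary_plus: "binary (+) \<in> kalmar_elementary"
  and kalmar_elementary_minus: "binary (-) \<in> kalmar_elementary"
  using kalmar_elementary_base by auto

section \<open>Successor, exponentiation and remainder are elementary\<close>

lemma kalmar_elementary_Suc: "unary (\<lambda>x. x + 1) \<in> kalmar_elementary"
  unfolding unary_def
  by (intro kalmar_elementary_add kalmar_elementary_plus kalmar_elementary_const
      kalmar_elementary_nth) auto

lemma kalmar_elementary_exp: "unary (\<lambda>x. 2 ^ x) \<in> kalmar_elementary"
proof -
  have "unary (\<lambda>x. 2 ^ x) = operation 1 (\<lambda>xs. \<Prod>z<last xs. 2)"
    by (auto simp: unary_def operation_eq_iff length_Suc_conv)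
  then show ?thesis
    using kalmar_elementary_prod[OF kalmar_elementary_const[of 1 2]] by simp
qed

lemma kalmar_elementary_times: "binary (*) \<in> kalmar_elementary"
proof -
  have "binary (*) = operation 2 (\<lambda>xs. \<Sum>z<last xs. (butlast xs @ [z]) ! 0)"
    by (auto simp: binary_def operation_eq_iff numeral_2_eq_2 length_Suc_conv)
  then show ?thesis
    using kalmar_elementary_sum[OF kalmar_elementary_nth[of 0 2]] by simp
qed

text \<open>For \<open>y = 0\<close> the sum equals \<open>x\<close> instead of \<open>x div y\<close>, which is harmless in
  \<open>x mod y = x - y * (x div y)\<close>.\<close>

lemma div_eq_sum:
  fixes x y :: nat
  assumes "y > 0"
  shows "x div y = (\<Sum>z<x. 1 - ((z + 1) * y - x))"
proof -
  \<comment> \<open>A summand is 1 exactly if \<open>(z + 1) * y \<le> x\<close>, so the sum counts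
    the positive multiples of \<open>y\<close> up to \<open>x\<close>. The range
    \<open>z < x\<close> suffices because \<open>x div y \<le> x\<close>.\<close>
  have "(\<Sum>z<x. 1 - ((z + 1) * y - x)) = (\<Sum>z<x. if z < x div y then 1 else 0)"
  proof (rule sum.cong[OF refl])
    fix z
    have "z < x div y \<longleftrightarrow> (z + 1) * y \<le> x"
      using less_eq_div_iff_mult_less_eq[OF assms, of "z + 1" x] by auto
    then show "1 - ((z + 1) * y - x) = (if z < x div y then 1 else 0)"
      by auto
  qed
  also have "\<dots> = card ({..<x} \<inter> {z. z < x div y})"
    by (simp add: sum.If_cases)
  also have "{..<x} \<inter> {z. z < x div y} = {..<x div y}"
    using div_le_dividend[of x y] by (auto intro: less_le_trans)
  finally show ?thesis by simp
qed

text \<open>Bounded summation uses the last argument as its bound, whereas here the bound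
  \<open>x\<close> also occurs in the summand. Hence the sum is formed with a separate bound
  \<open>w\<close> as a ternary operation, and \<open>x\<close> is substituted for \<open>w\<close>
  afterwards.\<close>

lemma kalmar_elementary_mod: "binary (\<lambda>x y. x mod y) \<in> kalmar_elementary"
proof -
  let ?s = "\<lambda>x y w :: nat. \<Sum>z<w. 1 - ((z + 1) * y - x)"
  have "operation 3 (\<lambda>xs. 1 - ((xs ! 2 + 1) * xs ! 1 - xs ! 0)) \<in> kalmar_elementary"
    by (intro kalmar_elementary_diff kalmar_elementary_minus kalmar_elementary_add
        kalmar_elementary_plus kalmar_elementary_binary[OF kalmar_elementary_times]
        kalmar_elementary_const kalmar_elementary_nth) auto
  from kalmar_elementary_sum[OF this]
  have "operation 3 (\<lambda>xs. ?s (xs ! 0) (xs ! 1) (xs ! 2)) \<in> kalmar_elementary"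
    by (rule back_subst[of "\<lambda>f. f \<in> kalmar_elementary"])
      (auto simp: operation_eq_iff numeral_3_eq_3 numeral_2_eq_2 length_Suc_conv)
  then have s: "operation 2 (\<lambda>xs. ?s (xs ! 0) (xs ! 1) (xs ! 0)) \<in> kalmar_elementary"
    using closed_substitutionD[of kalmar_elementary 3 "\<lambda>xs. ?s (xs ! 0) (xs ! 1) (xs ! 2)"
        "[\<lambda>xs. xs ! 0, \<lambda>xs. xs ! 1, \<lambda>xs. xs ! 0]" 2]
      kalmar_elementary_closed kalmar_elementary_nth[of 0 2] kalmar_elementary_nth[of 1 2]
    by (fastforce simp: numeral_2_eq_2)
  have "operation 2 (\<lambda>xs. xs ! 0 - xs ! 1 * ?s (xs ! 0) (xs ! 1) (xs ! 0)) \<in> kalmar_elementary"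
    by (intro kalmar_elementary_diff kalmar_elementary_minus s
        kalmar_elementary_binary[OF kalmar_elementary_times] kalmar_elementary_nth) auto
  moreover have "x mod y = x - y * ?s x y x" for x y :: nat
    using div_eq_sum[of y x] by (cases "y = 0") (simp_all flip: minus_mult_div_eq_mod)
  ultimately show ?thesis
    by (simp add: binary_def)
qed

section \<open>Functions with few large values\<close>

text \<open>The order of the quantifiers matters: \<open>K\<close> comes before \<open>n\<close>, so
  \<open>x\<close> can run through more than \<open>K\<close> values, and \<open>T\<close> comes
  before \<open>y\<close>, so \<open>y\<close> can exceed \<open>T\<close>. Only the exceptional set
  \<open>L\<close> may depend on \<open>y\<close>.\<close>

definition few_large_values :: "(nat \<Rightarrow> nat \<Rightarrow> nat) \<Rightarrow> bool" where
  "few_large_values h \<longleftrightarrow> (\<exists>K. \<forall>n. \<exists>T. \<forall>y. \<exists>L. finite L \<and> card L \<le> K \<and>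
     (\<forall>x\<le>n. h x y \<le> T \<or> h x y \<in> L))"

lemma few_large_values_const: "few_large_values (\<lambda>x y. c)"
  unfolding few_large_values_def by (intro exI[of _ 0] allI exI[of _ c] exI[of _ "{}"]) auto

lemma few_large_values_fst: "few_large_values (\<lambda>x y. x)"
  unfolding few_large_values_def
proof (rule exI[of _ 0], rule allI)
  fix n :: nat
  show "\<exists>T. \<forall>y::nat. \<exists>L. finite L \<and> card L \<le> 0 \<and> (\<forall>x\<le>n. x \<le> T \<or> x \<in> L)"
    by (intro exI[of _ n] allI exI[of _ "{}"]) auto
qed

lemma few_large_values_snd: "few_large_values (\<lambda>x y. y)"
  unfolding few_large_values_def
proof (rule exI[of _ 1], rule allI, rule exI[of _ 0], rule allI)
  fix n y :: nat
  show "\<exists>L. finite L \<and> card L \<le> 1 \<and> (\<forall>x\<le>n. y \<le> 0 \<or> y \<in> L)"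
    by (intro exI[of _ "{y}"]) auto
qed

text \<open>Monotonicity turns the bound \<open>T\<close> into \<open>g T\<close>, and the image of
  the exceptional set has no more elements than the set itself. This covers successor and
  \<open>2 ^ x\<close>.\<close>

lemma few_large_values_mono:
  assumes "mono g" "few_large_values h"
  shows "few_large_values (\<lambda>x y. g (h x y))"
proof -
  obtain K where K: "\<And>n. \<exists>T. \<forall>y. \<exists>L. finite L \<and> card L \<le> K \<and> (\<forall>x\<le>n. h x y \<le> T \<or> h x y \<in> L)"
    using assms(2) unfolding few_large_values_def by blast
  show ?thesis
    unfolding few_large_values_def
  proof (rule exI[of _ K], rule allI)
    fix n
    obtain T where T: "\<And>y. \<exists>L. finite L \<and> card L \<le> K \<and> (\<forall>x\<le>n. h x y \<le> T \<or> h x y \<in> L)"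
      using K by blast
    show "\<exists>T. \<forall>y. \<exists>L. finite L \<and> card L \<le> K \<and> (\<forall>x\<le>n. g (h x y) \<le> T \<or> g (h x y) \<in> L)"
    proof (intro exI[of _ "g T"] allI)
      fix y
      obtain L where L: "finite L" "card L \<le> K" "\<And>x. x \<le> n \<Longrightarrow> h x y \<le> T \<or> h x y \<in> L"
        using T by blast
      then have "finite (g ` L)" "card (g ` L) \<le> K"
        using card_image_le[of L g] by auto
      moreover have "g (h x y) \<le> g T \<or> g (h x y) \<in> g ` L" if "x \<le> n" for x
        using L(3)[OF that] \<open>mono g\<close> by (auto dest: monoD)
      ultimately show "\<exists>L. finite L \<and> card L \<le> K \<and> (\<forall>x\<le>n. g (h x y) \<le> g T \<or> g (h x y) \<in> L)"
        by blast
    qed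
  qed
qed

lemma few_large_values_mod:
  assumes "few_large_values a" "few_large_values b"
  shows "few_large_values (\<lambda>x y. a x y mod b x y)"
proof -
  obtain A where A: "\<And>n. \<exists>T. \<forall>y. \<exists>L. finite L \<and> card L \<le> A \<and> (\<forall>x\<le>n. a x y \<le> T \<or> a x y \<in> L)"
    using assms(1) unfolding few_large_values_def by blast
  obtain B where B: "\<And>n. \<exists>T. \<forall>y. \<exists>L. finite L \<and> card L \<le> B \<and> (\<forall>x\<le>n. b x y \<le> T \<or> b x y \<in> L)"
    using assms(2) unfolding few_large_values_def by blast
  show ?thesis
    unfolding few_large_values_def
  proof (rule exI[of _ "A * Suc B"], rule allI)
    fix n
    obtain S where S: "\<And>y. \<exists>L. finite L \<and> card L \<le> A \<and> (\<forall>x\<le>n. a x y \<le> S \<or> a x y \<in> L)"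
      using A by blast
    obtain T where T: "\<And>y. \<exists>L. finite L \<and> card L \<le> B \<and> (\<forall>x\<le>n. b x y \<le> T \<or> b x y \<in> L)"
      using B by blast
    show "\<exists>T. \<forall>y. \<exists>L. finite L \<and> card L \<le> A * Suc B \<and>
        (\<forall>x\<le>n. a x y mod b x y \<le> T \<or> a x y mod b x y \<in> L)"
    proof (intro exI[of _ "max S T"] allI)
      fix y
      obtain L where L: "finite L" "card L \<le> A" "\<And>x. x \<le> n \<Longrightarrow> a x y \<le> S \<or> a x y \<in> L"
        using S by blast
      obtain M where M: "finite M" "card M \<le> B" "\<And>x. x \<le> n \<Longrightarrow> b x y \<le> T \<or> b x y \<in> M"
        using T by blast
      \<comment> \<open>The divisor 0 is added since \<open>b x y = 0\<close> is small but leaves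
        the remainder \<open>a x y\<close>, which may be large. This accounts for the factor
        \<open>Suc B\<close>.\<close>
      let ?N = "(\<lambda>(u, v). u mod v) ` (L \<times> insert 0 M)"
      have "card ?N \<le> card (L \<times> insert 0 M)"
        using L(1) M(1) by (intro card_image_le) auto
      also have "\<dots> \<le> A * Suc B"
        unfolding card_cartesian_product
        using L(2) M(1,2) by (intro mult_le_mono) (auto simp: card_insert_if)
      finally have "card ?N \<le> A * Suc B" .
      moreover have "a x y mod b x y \<le> max S T \<or> a x y mod b x y \<in> ?N" if "x \<le> n" for x
      proof (cases "a x y \<in> L \<and> b x y \<in> insert 0 M")
        case True
        then show ?thesis by force
      next
        case False
        \<comment> \<open>A remainder is at most its dividend and less than a nonzero divisor, so
          either alternative bounds it by \<open>max S T\<close>.\<close>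
        then have "a x y \<le> S \<or> 0 < b x y \<and> b x y \<le> T"
          using L(3)[OF that] M(3)[OF that] by auto
        then have "a x y mod b x y \<le> max S T"
          using mod_less_eq_dividend[of "a x y" "b x y"] mod_less_divisor[of "b x y" "a x y"]
          by linarith
        then show ?thesis ..
      qed
      ultimately show "\<exists>L. finite L \<and> card L \<le> A * Suc B \<and>
          (\<forall>x\<le>n. a x y mod b x y \<le> max S T \<or> a x y mod b x y \<in> L)"
        using L(1) M(1) by (intro exI[of _ ?N]) auto
    qed
  qed
qed

lemma not_few_large_values_add: "\<not> few_large_values (\<lambda>x y. x + y)"
proof
  assume "few_large_values (\<lambda>x y. x + y)"
  then obtain K where "\<And>n :: nat. \<exists>T :: nat. \<forall>y. \<exists>L. finite L \<and> card L \<le> K \<and>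
      (\<forall>x\<le>n. x + y \<le> T \<or> x + y \<in> L)"
    unfolding few_large_values_def by blast
  \<comment> \<open>With \<open>n = K\<close> there are \<open>K + 1\<close> choices of
    \<open>x\<close>, one more than \<open>L\<close> can hold.\<close>
  from this[of K] obtain T where "\<And>y :: nat. \<exists>L. finite L \<and> card L \<le> K \<and>
      (\<forall>x\<le>K. x + y \<le> T \<or> x + y \<in> L)"
    by blast
  \<comment> \<open>This \<open>y\<close> lifts every sum above \<open>T\<close>, so all of these
    distinct sums are forced into \<open>L\<close>.\<close>
  from this[of "Suc T"] obtain L where L: "finite L" "card L \<le> K"
    "\<forall>x\<le>K. x + Suc T \<le> T \<or> x + Suc T \<in> L"
    by blast
  have "(\<lambda>x. x + Suc T) ` {..K} \<subseteq> L"
    using L(3) by (simp add: image_subset_iff)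
  from card_mono[OF L(1) this] have "card ((\<lambda>x. x + Suc T) ` {..K}) \<le> K"
    using L(2) by (rule order_trans)
  then show False
    by (simp add: card_image inj_on_def)
qed

section \<open>Operations that preserve few large values\<close>

text \<open>Admitting all tuples \<open>hs\<close> of functions with few large values, not just
  \<open>x\<close> and \<open>y\<close>, gives an invariant for operations of every arity that is
  stable under substitution.\<close>

definition preserves_few_large_values :: "operation set" where
  "preserves_few_large_values = {f. \<forall>hs. length hs = arity f \<longrightarrow> (\<forall>h\<in>set hs. few_large_values h) \<longrightarrow>
     few_large_values (\<lambda>x y. app f (map (\<lambda>h. h x y) hs))}"

lemma operation_preserves_iff:
  "operation r f \<in> preserves_few_large_values \<longleftrightarrow>
     (\<forall>hs. length hs = r \<longrightarrow> (\<forall>h\<in>set hs. few_large_values h) \<longrightarrow>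
       few_large_values (\<lambda>x y. f (map (\<lambda>h. h x y) hs)))"
  by (simp add: preserves_few_large_values_def operation_def)

lemma unary_preserves_iff:
  "unary g \<in> preserves_few_large_values \<longleftrightarrow>
     (\<forall>h. few_large_values h \<longrightarrow> few_large_values (\<lambda>x y. g (h x y)))"
  by (auto simp: unary_def operation_preserves_iff length_Suc_conv)

lemma binary_preserves_iff:
  "binary g \<in> preserves_few_large_values \<longleftrightarrow>
     (\<forall>a b. few_large_values a \<longrightarrow> few_large_values b \<longrightarrow> few_large_values (\<lambda>x y. g (a x y) (b x y)))"
  unfolding binary_def operation_preserves_iff numeral_2_eq_2 length_Suc_conv
  by fastforce

lemma closed_substitution_preserves: "closed_substitution preserves_few_large_values"
  unfolding closed_substitution_def
proof (intro ballI allI impI, elim conjE)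
  fix f n gs
  assume f: "f \<in> preserves_few_large_values" and len: "length gs = arity f"
    and gs: "\<forall>g\<in>set gs. g \<in> preserves_few_large_values \<and> arity g = n"
  show "operation n (\<lambda>xs. app f (map (\<lambda>g. app g xs) gs)) \<in> preserves_few_large_values"
    unfolding operation_preserves_iff
  proof (intro allI impI)
    fix hs :: "(nat \<Rightarrow> nat \<Rightarrow> nat) list"
    assume hs: "length hs = n" "\<forall>h\<in>set hs. few_large_values h"
    \<comment> \<open>The inner operations applied to \<open>hs\<close> have few large values again
      and are thus admissible arguments of \<open>f\<close>.\<close>
    let ?ks = "map (\<lambda>g x y. app g (map (\<lambda>h. h x y) hs)) gs"
    have "\<forall>k\<in>set ?ks. few_large_values k"
      using gs hs by (auto simp: preserves_few_large_values_def)
    then have "few_large_values (\<lambda>x y. app f (map (\<lambda>k. k x y) ?ks))"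
      using f len unfolding preserves_few_large_values_def by (auto simp del: map_map)
    then show "few_large_values (\<lambda>x y. app f (map (\<lambda>g. app g (map (\<lambda>h. h x y) hs)) gs))"
      by (simp add: comp_def)
  qed
qed

lemma generated_preserves:
  "\<langle>{unary (\<lambda>x. x + 1), binary (\<lambda>x y. x mod y), unary (\<lambda>x. 2 ^ x)}\<rangle> \<subseteq> preserves_few_large_values"
  unfolding generated_def
proof (rule hull_minimal)
  have "constants \<union> projections \<subseteq> preserves_few_large_values"
    by (auto simp: constants_def projections_def operation_preserves_iff few_large_values_const)
  moreover have "unary (\<lambda>x. x + 1) \<in> preserves_few_large_values"
    unfolding unary_preserves_iff
    by (intro allI impI, rule few_large_values_mono[where g = "\<lambda>x. x + 1"]) (auto intro: monoI)
  moreover have "unary (\<lambda>x. 2 ^ x) \<in> preserves_few_large_values"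
    unfolding unary_preserves_iff
    by (intro allI impI, rule few_large_values_mono[where g = "\<lambda>x. 2 ^ x"]) (auto intro: monoI)
  moreover have "binary (\<lambda>x y. x mod y) \<in> preserves_few_large_values"
    unfolding binary_preserves_iff by (intro allI impI, rule few_large_values_mod)
  ultimately show "{unary (\<lambda>x. x + 1), binary (\<lambda>x y. x mod y), unary (\<lambda>x. 2 ^ x)} \<union> constants \<union>
      projections \<subseteq> preserves_few_large_values"
    by blast
qed (rule closed_substitution_preserves)

lemma plus_not_preserves: "binary (+) \<notin> preserves_few_large_values"
  unfolding binary_preserves_iff
  \<comment> \<open>The two coordinate functions are admissible arguments, but their sum takes too
    many large values.\<close>
  by (intro notI, drule spec[of _ "\<lambda>x y. x"], drule spec[of _ "\<lambda>x y. y"])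
    (simp add: few_large_values_fst few_large_values_snd not_few_large_values_add)

theorem theorem13:
  "\<langle>{unary (\<lambda>x. x + 1), binary (\<lambda>x y. x mod y), unary (\<lambda>x. 2 ^ x)}\<rangle> \<subset> kalmar_elementary"
proof
  show "\<langle>{unary (\<lambda>x. x + 1), binary (\<lambda>x y. x mod y), unary (\<lambda>x. 2 ^ x)}\<rangle> \<subseteq> kalmar_elementary"
    unfolding generated_def
    using kalmar_elementary_base kalmar_elementary_closed kalmar_elementary_Suc
      kalmar_elementary_mod kalmar_elementary_exp
    by (intro hull_minimal) auto
  show "\<langle>{unary (\<lambda>x. x + 1), binary (\<lambda>x y. x mod y), unary (\<lambda>x. 2 ^ x)}\<rangle> \<noteq> kalmar_elementary"
    using generated_preserves plus_not_preserves kalmar_elementary_plus by blast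
qed

end
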